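(* Let $\chi\colon\mathbb T\mathbb S\to\mathbb S\mathbb T$ be a comonad distributive law between comonads $\mathbb T=(T,\Delta^T,\epsilon^T)$ and $\mathbb S=(S,\Delta^S,\epsilon^S)$ on a category $\mathcal B$. Given an $\mathbb S$-coalgebra $(M,\mathcal Y,\nabla^S)$ and a $\mathbb T$-opcoalgebra $(N,\mathcal Z,\nabla^T)$, there are $1$-cells in the $2$-category $\mathsf{Dist}$ $$(M,\ \epsilon^TM,\ \nabla^S)\colon(\mathcal Y,\mathrm{id},\mathrm{id},\mathrm{id})\to(\mathcal B,\chi,\mathbb T,\mathbb S),\qquad (N,\ \nabla^T,\ N\epsilon^S)\colon(\mathcal B,\chi,\mathbb T,\mathbb S)\to(\mathcal Z,\mathrm{id},\mathrm{id},\mathrm{id}),$$ where $(\mathcal Y,\mathrm{id},\mathrm{id},\mathrm{id})$ and $(\mathcal Z,\mathrm{id},\mathrm{id},\mathrm{id})$ are the trivial distributive laws (identity law between identity comonads). Moreover, all $1$-cells from a trivial distributive law to $\chi$, respectively from $\chi$ to a trivial distributive law, are of this form.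
   Context: Juxtaposition denotes composition of functors and whiskering. An $\mathbb S$-coalgebra $(M,\mathcal Y,\nabla^S)$ is a functor $M\colon\mathcal Y\to\mathcal B$ with a natural transformation $\nabla^S\colon M\to SM$ such that $\Delta^SM\circ\nabla^S=S\nabla^S\circ\nabla^S$ and $\epsilon^SM\circ\nabla^S=\mathrm{id}$. Dually, a $\mathbb T$-opcoalgebra $(N,\mathcal Z,\nabla^T)$ is a functor $N\colon\mathcal B\to\mathcal Z$ with a natural transformation $\nabla^T\colon N\to NT$ such that $N\Delta^T\circ\nabla^T=\nabla^TT\circ\nabla^T$ and $N\epsilon^T\circ\nabla^T=\mathrm{id}$. A comonad distributive law $\chi\colon\mathbb T\mathbb S\to\mathbb S\mathbb T$ is a natural transformation $\chi\colon TS\to ST$ with $S\epsilon^T\circ\chi=\epsilon^TS$, $S\Delta^T\circ\chi=\chi T\circ T\chi\circ\Delta^TS$, $\epsilon^ST\circ\chi=T\epsilon^S$, $\Delta^ST\circ\chi=S\chi\circ\chi S\circ T\Delta^S$. $\mathsf{Dist}$ has as $0$-cells quadruples $(\mathcal B,\chi,\mathbb T,\mathbb S)$ with $\chi\colon\mathbb T\mathbb S\to\mathbb S\mathbb T$ a comonad distributive law on $\mathcal B$. A $1$-cell $(\mathcal B,\chi,\mathbb T,\mathbb S)\to(\mathcal D,\tau,\mathbb G,\mathbb C)$ is a triple $(\Sigma,\sigma,\gamma)$ with $\Sigma\colon\mathcal B\to\mathcal D$ a functor, $\sigma\colon G\Sigma\to\Sigma T$ a lax morphism of comonads ($\Sigma\epsilon^T\circ\sigma=\epsilon^G\Sigma$,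 $\Sigma\Delta^T\circ\sigma=\sigma T\circ G\sigma\circ\Delta^G\Sigma$), and $\gamma\colon\Sigma S\to C\Sigma$ a colax morphism of comonads ($\epsilon^C\Sigma\circ\gamma=\Sigma\epsilon^S$, $\Delta^C\Sigma\circ\gamma=C\gamma\circ\gamma S\circ\Sigma\Delta^S$), such that $\gamma T\circ\Sigma\chi\circ\sigma S=C\sigma\circ\tau\Sigma\circ G\gamma$. *)

theory Defs
  imports Main "HOL-Library.FuncSet"
begin

text \<open>
  Functors and natural transformations carry their source and target, and their underlying maps
  are \<open>extensional\<close> (equal to \<open>undefined\<close> off the source category).  Hence HOL equality of these
  records is equality of functors and of natural transformations; in particular composition of
  functors is strictly associative and unital.
\<close>

record ('o, 'a) cat =
  Obj :: "'o set"
  Arr :: "'a set"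
  Dom :: "'a \<Rightarrow> 'o"
  Cod :: "'a \<Rightarrow> 'o"
  Idn :: "'o \<Rightarrow> 'a"
  Cmp :: "'a \<Rightarrow> 'a \<Rightarrow> 'a"

locale category =
  fixes C :: "('o, 'a) cat"
  assumes dom_obj: "f \<in> Arr C \<Longrightarrow> Dom C f \<in> Obj C"
    and cod_obj: "f \<in> Arr C \<Longrightarrow> Cod C f \<in> Obj C"
    and idn_arr: "x \<in> Obj C \<Longrightarrow> Idn C x \<in> Arr C"
    and dom_idn: "x \<in> Obj C \<Longrightarrow> Dom C (Idn C x) = x"
    and cod_idn: "x \<in> Obj C \<Longrightarrow> Cod C (Idn C x) = x"
    and cmp_arr: "\<lbrakk>f \<in> Arr C; g \<in> Arr C; Cod C f = Dom C g\<rbrakk> \<Longrightarrow> Cmp C g f \<in> Arr C"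
    and dom_cmp: "\<lbrakk>f \<in> Arr C; g \<in> Arr C; Cod C f = Dom C g\<rbrakk> \<Longrightarrow> Dom C (Cmp C g f) = Dom C f"
    and cod_cmp: "\<lbrakk>f \<in> Arr C; g \<in> Arr C; Cod C f = Dom C g\<rbrakk> \<Longrightarrow> Cod C (Cmp C g f) = Cod C g"
    and cmp_idn: "f \<in> Arr C \<Longrightarrow> Cmp C f (Idn C (Dom C f)) = f"
    and idn_cmp: "f \<in> Arr C \<Longrightarrow> Cmp C (Idn C (Cod C f)) f = f"
    and cmp_assoc: "\<lbrakk>f \<in> Arr C; g \<in> Arr C; h \<in> Arr C; Cod C f = Dom C g; Cod C g = Dom C h\<rbrakk>
      \<Longrightarrow> Cmp C h (Cmp C g f) = Cmp C (Cmp C h g) f"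

record ('o, 'a, 'p, 'b) ftor =
  fsrc :: "('o, 'a) cat"
  ftgt :: "('p, 'b) cat"
  fobj :: "'o \<Rightarrow> 'p"
  farr :: "'a \<Rightarrow> 'b"

locale is_functor = src: category C + tgt: category D
  for C :: "('o, 'a) cat" and D :: "('p, 'b) cat" +
  fixes F :: "('o, 'a, 'p, 'b) ftor"
  assumes fsrc: "fsrc F = C"
    and ftgt: "ftgt F = D"
    and fobj_ext: "fobj F \<in> extensional (Obj C)"
    and farr_ext: "farr F \<in> extensional (Arr C)"
    and fobj_obj: "x \<in> Obj C \<Longrightarrow> fobj F x \<in> Obj D"
    and farr_arr: "f \<in> Arr C \<Longrightarrow> farr F f \<in> Arr D"
    and dom_farr: "f \<in> Arr C \<Longrightarrow> Dom D (farr F f) = fobj F (Dom C f)"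
    and cod_farr: "f \<in> Arr C \<Longrightarrow> Cod D (farr F f) = fobj F (Cod C f)"
    and farr_idn: "x \<in> Obj C \<Longrightarrow> farr F (Idn C x) = Idn D (fobj F x)"
    and farr_cmp: "\<lbrakk>f \<in> Arr C; g \<in> Arr C; Cod C f = Dom C g\<rbrakk>
      \<Longrightarrow> farr F (Cmp C g f) = Cmp D (farr F g) (farr F f)"

definition id_ftor :: "('o, 'a) cat \<Rightarrow> ('o, 'a, 'o, 'a) ftor" where
  "id_ftor C = \<lparr>fsrc = C, ftgt = C, fobj = (\<lambda>x\<in>Obj C. x), farr = (\<lambda>f\<in>Arr C. f)\<rparr>"

definition fcomp ::
  "('p, 'b, 'q, 'c) ftor \<Rightarrow> ('o, 'a, 'p, 'b) ftor \<Rightarrow> ('o, 'a, 'q, 'c) ftor" (infixr "\<odot>" 75) where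
  "G \<odot> F = \<lparr>fsrc = fsrc F, ftgt = ftgt G,
     fobj = (\<lambda>x\<in>Obj (fsrc F). fobj G (fobj F x)),
     farr = (\<lambda>f\<in>Arr (fsrc F). farr G (farr F f))\<rparr>"

record ('o, 'a, 'p, 'b) ntrans =
  nsrc :: "('o, 'a, 'p, 'b) ftor"
  ntgt :: "('o, 'a, 'p, 'b) ftor"
  ncmp :: "'o \<Rightarrow> 'b"

locale natural_transformation = F: is_functor C D F + G: is_functor C D G
  for C :: "('o, 'a) cat" and D :: "('p, 'b) cat"
    and F :: "('o, 'a, 'p, 'b) ftor" and G :: "('o, 'a, 'p, 'b) ftor" +
  fixes \<alpha> :: "('o, 'a, 'p, 'b) ntrans"
  assumes nsrc: "nsrc \<alpha> = F"
    and ntgt: "ntgt \<alpha> = G"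
    and ncmp_ext: "ncmp \<alpha> \<in> extensional (Obj C)"
    and ncmp_arr: "x \<in> Obj C \<Longrightarrow> ncmp \<alpha> x \<in> Arr D"
    and dom_ncmp: "x \<in> Obj C \<Longrightarrow> Dom D (ncmp \<alpha> x) = fobj F x"
    and cod_ncmp: "x \<in> Obj C \<Longrightarrow> Cod D (ncmp \<alpha> x) = fobj G x"
    and naturality: "f \<in> Arr C \<Longrightarrow>
      Cmp D (ncmp \<alpha> (Cod C f)) (farr F f) = Cmp D (farr G f) (ncmp \<alpha> (Dom C f))"

definition id_nt :: "('o, 'a, 'p, 'b) ftor \<Rightarrow> ('o, 'a, 'p, 'b) ntrans" where
  "id_nt F = \<lparr>nsrc = F, ntgt = F, ncmp = (\<lambda>x\<in>Obj (fsrc F). Idn (ftgt F) (fobj F x))\<rparr>"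

text \<open>Vertical composition, in the order of composition of maps.\<close>

definition vcomp ::
  "('o, 'a, 'p, 'b) ntrans \<Rightarrow> ('o, 'a, 'p, 'b) ntrans \<Rightarrow> ('o, 'a, 'p, 'b) ntrans"
    (infixr "\<bullet>" 55) where
  "\<beta> \<bullet> \<alpha> = \<lparr>nsrc = nsrc \<alpha>, ntgt = ntgt \<beta>,
     ncmp = (\<lambda>x\<in>Obj (fsrc (nsrc \<alpha>)). Cmp (ftgt (nsrc \<alpha>)) (ncmp \<beta> x) (ncmp \<alpha> x))\<rparr>"

text \<open>The whiskerings \<open>F\<alpha>\<close> and \<open>\<alpha>F\<close> are written \<open>F \<rhd> \<alpha>\<close> and \<open>\<alpha> \<lhd> F\<close>.\<close>

definition whisker_left ::
  "('p, 'b, 'q, 'c) ftor \<Rightarrow> ('o, 'a, 'p, 'b) ntrans \<Rightarrow> ('o, 'a, 'q, 'c) ntrans"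
    (infixr "\<rhd>" 65) where
  "F \<rhd> \<alpha> = \<lparr>nsrc = F \<odot> nsrc \<alpha>, ntgt = F \<odot> ntgt \<alpha>,
     ncmp = (\<lambda>x\<in>Obj (fsrc (nsrc \<alpha>)). farr F (ncmp \<alpha> x))\<rparr>"

definition whisker_right ::
  "('p, 'b, 'q, 'c) ntrans \<Rightarrow> ('o, 'a, 'p, 'b) ftor \<Rightarrow> ('o, 'a, 'q, 'c) ntrans"
    (infixl "\<lhd>" 65) where
  "\<alpha> \<lhd> F = \<lparr>nsrc = nsrc \<alpha> \<odot> F, ntgt = ntgt \<alpha> \<odot> F,
     ncmp = (\<lambda>x\<in>Obj (fsrc F). ncmp \<alpha> (fobj F x))\<rparr>"

record ('o, 'a) comonad =
  Ftor :: "('o, 'a, 'o, 'a) ftor"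
  comult :: "('o, 'a, 'o, 'a) ntrans"
  counit :: "('o, 'a, 'o, 'a) ntrans"

definition is_comonad :: "('o, 'a) cat \<Rightarrow> ('o, 'a) comonad \<Rightarrow> bool" where
  "is_comonad B T \<longleftrightarrow>
     is_functor B B (Ftor T) \<and>
     natural_transformation B B (Ftor T) (Ftor T \<odot> Ftor T) (comult T) \<and>
     natural_transformation B B (Ftor T) (id_ftor B) (counit T) \<and>
     (Ftor T \<rhd> comult T) \<bullet> comult T = (comult T \<lhd> Ftor T) \<bullet> comult T \<and>
     (Ftor T \<rhd> counit T) \<bullet> comult T = id_nt (Ftor T) \<and>
     (counit T \<lhd> Ftor T) \<bullet> comult T = id_nt (Ftor T)"

definition id_comonad :: "('o, 'a) cat \<Rightarrow> ('o, 'a) comonad" where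
  "id_comonad B =
     \<lparr>Ftor = id_ftor B, comult = id_nt (id_ftor B), counit = id_nt (id_ftor B)\<rparr>"

definition is_coalgebra ::
  "('o, 'a) cat \<Rightarrow> ('o, 'a) comonad \<Rightarrow>
   ('y, 'ya, 'o, 'a) ftor \<Rightarrow> ('y, 'ya) cat \<Rightarrow> ('y, 'ya, 'o, 'a) ntrans \<Rightarrow> bool" where
  "is_coalgebra B S M Y \<nu> \<longleftrightarrow>
     is_functor Y B M \<and>
     natural_transformation Y B M (Ftor S \<odot> M) \<nu> \<and>
     (comult S \<lhd> M) \<bullet> \<nu> = (Ftor S \<rhd> \<nu>) \<bullet> \<nu> \<and>
     (counit S \<lhd> M) \<bullet> \<nu> = id_nt M"

definition is_opcoalgebra ::
  "('o, 'a) cat \<Rightarrow> ('o, 'a) comonad \<Rightarrow>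
   ('o, 'a, 'z, 'za) ftor \<Rightarrow> ('z, 'za) cat \<Rightarrow> ('o, 'a, 'z, 'za) ntrans \<Rightarrow> bool" where
  "is_opcoalgebra B T N Z \<nu> \<longleftrightarrow>
     is_functor B Z N \<and>
     natural_transformation B Z N (N \<odot> Ftor T) \<nu> \<and>
     (N \<rhd> comult T) \<bullet> \<nu> = (\<nu> \<lhd> Ftor T) \<bullet> \<nu> \<and>
     (N \<rhd> counit T) \<bullet> \<nu> = id_nt N"

definition is_distributive_law ::
  "('o, 'a) cat \<Rightarrow> ('o, 'a, 'o, 'a) ntrans \<Rightarrow> ('o, 'a) comonad \<Rightarrow> ('o, 'a) comonad \<Rightarrow> bool" where
  "is_distributive_law B \<chi> T S \<longleftrightarrow>
     natural_transformation B B (Ftor T \<odot> Ftor S) (Ftor S \<odot> Ftor T) \<chi> \<and>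
     (Ftor S \<rhd> counit T) \<bullet> \<chi> = counit T \<lhd> Ftor S \<and>
     (Ftor S \<rhd> comult T) \<bullet> \<chi> = (\<chi> \<lhd> Ftor T) \<bullet> (Ftor T \<rhd> \<chi>) \<bullet> (comult T \<lhd> Ftor S) \<and>
     (counit S \<lhd> Ftor T) \<bullet> \<chi> = Ftor T \<rhd> counit S \<and>
     (comult S \<lhd> Ftor T) \<bullet> \<chi> = (Ftor S \<rhd> \<chi>) \<bullet> (\<chi> \<lhd> Ftor S) \<bullet> (Ftor T \<rhd> comult S)"

type_synonym ('o, 'a) dist_quad =
  "('o, 'a) cat \<times> ('o, 'a, 'o, 'a) ntrans \<times> ('o, 'a) comonad \<times> ('o, 'a) comonad"

fun dist_0cell :: "('o, 'a) dist_quad \<Rightarrow> bool" where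
  "dist_0cell (B, \<chi>, T, S) \<longleftrightarrow>
     category B \<and> is_comonad B T \<and> is_comonad B S \<and> is_distributive_law B \<chi> T S"

fun dist_1cell ::
  "('o, 'a) dist_quad \<Rightarrow> ('p, 'b) dist_quad \<Rightarrow>
   ('o, 'a, 'p, 'b) ftor \<times> ('o, 'a, 'p, 'b) ntrans \<times> ('o, 'a, 'p, 'b) ntrans \<Rightarrow> bool" where
  "dist_1cell (B, \<chi>, T, S) (D, \<tau>, G, C) (\<Sigma>, \<sigma>, \<gamma>) \<longleftrightarrow>
     dist_0cell (B, \<chi>, T, S) \<and> dist_0cell (D, \<tau>, G, C) \<and>
     is_functor B D \<Sigma> \<and>
     natural_transformation B D (Ftor G \<odot> \<Sigma>) (\<Sigma> \<odot> Ftor T) \<sigma> \<and>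
     (\<Sigma> \<rhd> counit T) \<bullet> \<sigma> = counit G \<lhd> \<Sigma> \<and>
     (\<Sigma> \<rhd> comult T) \<bullet> \<sigma> = (\<sigma> \<lhd> Ftor T) \<bullet> (Ftor G \<rhd> \<sigma>) \<bullet> (comult G \<lhd> \<Sigma>) \<and>
     natural_transformation B D (\<Sigma> \<odot> Ftor S) (Ftor C \<odot> \<Sigma>) \<gamma> \<and>
     (counit C \<lhd> \<Sigma>) \<bullet> \<gamma> = \<Sigma> \<rhd> counit S \<and>
     (comult C \<lhd> \<Sigma>) \<bullet> \<gamma> = (Ftor C \<rhd> \<gamma>) \<bullet> (\<gamma> \<lhd> Ftor S) \<bullet> (\<Sigma> \<rhd> comult S) \<and>
     (\<gamma> \<lhd> Ftor T) \<bullet> (\<Sigma> \<rhd> \<chi>) \<bullet> (\<sigma> \<lhd> Ftor S) = (Ftor C \<rhd> \<sigma>) \<bullet> (\<tau> \<lhd> \<Sigma>) \<bullet> (Ftor G \<rhd> \<gamma>)"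

definition trivial_law :: "('o, 'a) cat \<Rightarrow> ('o, 'a) dist_quad" where
  "trivial_law C = (C, id_nt (id_ftor C), id_comonad C, id_comonad C)"

end

theory Submission
  imports Defs
begin

text \<open>
  In a 1-cell out of (resp. into) a trivial law, the counit axiom for \<open>\<sigma>\<close> (resp. \<open>\<gamma>\<close>) reads
  \<open>\<sigma> = \<epsilon>\<^sup>T\<Sigma>\<close> (resp. \<open>\<gamma> = \<Sigma>\<epsilon>\<^sup>S\<close>), and the axioms for the other transformation are the coalgebra
  (resp. opcoalgebra) axioms.  The remaining conditions are then automatic: comultiplicativity of
  \<open>\<epsilon>\<^sup>T\<Sigma>\<close> (resp. \<open>\<Sigma>\<epsilon>\<^sup>S\<close>) is a counit law of the comonad, and the compatibility with \<open>\<chi>\<close> reduces to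
  an interchange law by \<open>S\<epsilon>\<^sup>T \<circ> \<chi> = \<epsilon>\<^sup>TS\<close> (resp. \<open>\<epsilon>\<^sup>ST \<circ> \<chi> = T\<epsilon>\<^sup>S\<close>).
\<close>

section \<open>Calculus of whiskering and vertical composition\<close>

lemma is_functor_id_ftor:
  assumes "category C"
  shows "is_functor C C (id_ftor C)"
proof -
  interpret category C by fact
  show ?thesis
    by unfold_locales
      (auto simp: id_ftor_def dom_obj cod_obj idn_arr cmp_arr)
qed

lemma is_functor_fcomp:
  assumes "is_functor C D F" and "is_functor D E G"
  shows "is_functor C E (G \<odot> F)"
proof -
  interpret F: is_functor C D F by fact
  interpret G: is_functor D E G by fact
  show ?thesis
    by unfold_locales
      (auto simp: fcomp_def F.fsrc G.ftgt F.fobj_obj F.farr_arr G.fobj_obj G.farr_arr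
        F.dom_farr F.cod_farr G.dom_farr G.cod_farr F.farr_idn G.farr_idn F.farr_cmp G.farr_cmp
        F.src.dom_obj F.src.cod_obj F.src.idn_arr F.src.cmp_arr)
qed

lemma fcomp_id_ftor:
  assumes "is_functor C D F"
  shows "F \<odot> id_ftor C = F"
proof -
  interpret is_functor C D F by fact
  show ?thesis
    \<comment> \<open>Composing with the identity restricts the maps of \<open>F\<close> to the
      source, and extensionality says that this leaves them unchanged.\<close>
    using fobj_ext farr_ext
    by (cases F) (auto simp: fcomp_def id_ftor_def fsrc[symmetric] extensional_def fun_eq_iff)
qed

lemma id_ftor_fcomp:
  assumes "is_functor C D F"
  shows "id_ftor D \<odot> F = F"
proof -
  interpret is_functor C D F by fact
  show ?thesis
    using fobj_ext farr_ext fobj_obj farr_arr fsrc ftgt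
    by (cases F) (auto simp: fcomp_def id_ftor_def extensional_def fun_eq_iff)
qed

lemma fcomp_assoc:
  assumes "is_functor B C F" and "is_functor C D G"
  shows "H \<odot> G \<odot> F = (H \<odot> G) \<odot> F"
proof -
  interpret F: is_functor B C F by fact
  interpret G: is_functor C D G by fact
  show ?thesis
    by (auto simp: fcomp_def fun_eq_iff F.fsrc G.fsrc F.fobj_obj F.farr_arr restrict_def)
qed

section \<open>Identity and whiskered natural transformations\<close>

lemma natural_transformation_id_nt:
  assumes "is_functor C D F"
  shows "natural_transformation C D F F (id_nt F)"
proof -
  interpret is_functor C D F by fact
  show ?thesis
    \<comment> \<open>The naturality square has identities on two sides; by the unit laws both
      composites are the image of the arrow under \<open>F\<close>.\<close>
    by unfold_locales
      (auto simp: id_nt_def fsrc ftgt fobj_obj tgt.idn_arr tgt.dom_idn tgt.cod_idn src.dom_obj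
        src.cod_obj, metis cod_farr dom_farr farr_arr tgt.cmp_idn tgt.idn_cmp)
qed

lemma natural_transformation_whisker_left:
  assumes "natural_transformation C D F G \<alpha>" and "is_functor D E H"
  shows "natural_transformation C E (H \<odot> F) (H \<odot> G) (H \<rhd> \<alpha>)"
proof -
  interpret natural_transformation C D F G \<alpha> by fact
  interpret H: is_functor D E H by fact
  interpret HF: is_functor C E "H \<odot> F" by (rule is_functor_fcomp) unfold_locales
  interpret HG: is_functor C E "H \<odot> G" by (rule is_functor_fcomp) unfold_locales
  show ?thesis
  proof unfold_locales
    fix f assume f: "f \<in> Arr C"
    show "Cmp E (ncmp (H \<rhd> \<alpha>) (Cod C f)) (farr (H \<odot> F) f)
        = Cmp E (farr (H \<odot> G) f) (ncmp (H \<rhd> \<alpha>) (Dom C f))"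
      \<comment> \<open>The square is the image under \<open>H\<close> of the naturality square of
        \<open>\<alpha>\<close>, since \<open>H\<close> preserves composites.\<close>
      using naturality[OF f, THEN arg_cong, of "farr H"] f
      by (simp add: whisker_left_def fcomp_def nsrc F.fsrc G.fsrc F.src.dom_obj F.src.cod_obj
          H.farr_cmp ncmp_arr dom_ncmp cod_ncmp F.farr_arr F.cod_farr G.farr_arr G.dom_farr)
  qed (auto simp: whisker_left_def fcomp_def nsrc ntgt F.fsrc G.fsrc H.farr_arr H.dom_farr
      H.cod_farr ncmp_arr dom_ncmp cod_ncmp)
qed

lemma natural_transformation_whisker_right:
  assumes "natural_transformation C D F G \<alpha>" and "is_functor B C H"
  shows "natural_transformation B D (F \<odot> H) (G \<odot> H) (\<alpha> \<lhd> H)"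
proof -
  interpret natural_transformation C D F G \<alpha> by fact
  interpret H: is_functor B C H by fact
  interpret FH: is_functor B D "F \<odot> H" by (rule is_functor_fcomp) unfold_locales
  interpret GH: is_functor B D "G \<odot> H" by (rule is_functor_fcomp) unfold_locales
  show ?thesis
  proof unfold_locales
    fix f assume f: "f \<in> Arr B"
    show "Cmp D (ncmp (\<alpha> \<lhd> H) (Cod B f)) (farr (F \<odot> H) f)
        = Cmp D (farr (G \<odot> H) f) (ncmp (\<alpha> \<lhd> H) (Dom B f))"
      \<comment> \<open>Here naturality of \<open>\<alpha>\<close> is taken at the arrow
        \<open>farr H f\<close>.\<close>
      using naturality[OF H.farr_arr[OF f]] f
      by (simp add: whisker_right_def fcomp_def H.fsrc H.src.dom_obj H.src.cod_obj
          H.dom_farr H.cod_farr)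
  qed (auto simp: whisker_right_def fcomp_def nsrc ntgt H.fsrc H.fobj_obj ncmp_arr dom_ncmp
      cod_ncmp)
qed

section \<open>Unit and associativity laws for vertical composition; whiskering with
  identities\<close>

lemma id_nt_vcomp:
  assumes "natural_transformation C D F G \<alpha>"
  shows "id_nt G \<bullet> \<alpha> = \<alpha>"
proof -
  interpret natural_transformation C D F G \<alpha> by fact
  have "Cmp D (Idn D (fobj G x)) (ncmp \<alpha> x) = ncmp \<alpha> x" if "x \<in> Obj C" for x
    using F.tgt.idn_cmp[OF ncmp_arr[OF that]] that by (simp add: cod_ncmp)
  then show ?thesis
    using nsrc ntgt ncmp_ext
    by (cases \<alpha>) (auto simp: vcomp_def id_nt_def F.fsrc F.ftgt G.fsrc G.ftgt extensional_def
        fun_eq_iff)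
qed

lemma vcomp_id_nt:
  assumes "natural_transformation C D F G \<alpha>"
  shows "\<alpha> \<bullet> id_nt F = \<alpha>"
proof -
  interpret natural_transformation C D F G \<alpha> by fact
  have "Cmp D (ncmp \<alpha> x) (Idn D (fobj F x)) = ncmp \<alpha> x" if "x \<in> Obj C" for x
    using F.tgt.cmp_idn[OF ncmp_arr[OF that]] that by (simp add: dom_ncmp)
  then show ?thesis
    using nsrc ntgt ncmp_ext
    by (cases \<alpha>) (auto simp: vcomp_def id_nt_def F.fsrc F.ftgt extensional_def fun_eq_iff)
qed

lemma vcomp_assoc:
  assumes "natural_transformation C D F G \<alpha>" and "natural_transformation C D G H \<beta>"
    and "natural_transformation C D H K \<gamma>"
  shows "\<gamma> \<bullet> \<beta> \<bullet> \<alpha> = (\<gamma> \<bullet> \<beta>) \<bullet> \<alpha>"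
proof -
  interpret \<alpha>: natural_transformation C D F G \<alpha> by fact
  interpret \<beta>: natural_transformation C D G H \<beta> by fact
  interpret \<gamma>: natural_transformation C D H K \<gamma> by fact
  show ?thesis
    by (auto simp: vcomp_def fun_eq_iff restrict_def \<alpha>.nsrc \<beta>.nsrc \<alpha>.F.fsrc \<alpha>.F.ftgt \<alpha>.G.fsrc
        \<alpha>.G.ftgt \<alpha>.ncmp_arr \<alpha>.cod_ncmp \<beta>.ncmp_arr \<beta>.dom_ncmp \<beta>.cod_ncmp \<gamma>.ncmp_arr \<gamma>.dom_ncmp
        intro!: \<alpha>.F.tgt.cmp_assoc)
qed

lemma whisker_left_id_nt:
  assumes "is_functor C D F" and "is_functor D E H"
  shows "H \<rhd> id_nt F = id_nt (H \<odot> F)"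
proof -
  interpret F: is_functor C D F by fact
  interpret H: is_functor D E H by fact
  show ?thesis
    by (auto simp: whisker_left_def id_nt_def fcomp_def fun_eq_iff restrict_def F.fsrc F.ftgt
        H.ftgt H.farr_idn F.fobj_obj)
qed

lemma whisker_right_id_nt:
  assumes "is_functor C D F" and "is_functor B C H"
  shows "id_nt F \<lhd> H = id_nt (F \<odot> H)"
proof -
  interpret F: is_functor C D F by fact
  interpret H: is_functor B C H by fact
  show ?thesis
    by (auto simp: whisker_right_def id_nt_def fcomp_def fun_eq_iff restrict_def F.fsrc F.ftgt
        H.fsrc H.fobj_obj)
qed

lemma id_ftor_whisker_left:
  assumes "natural_transformation C D F G \<alpha>"
  shows "id_ftor D \<rhd> \<alpha> = \<alpha>"
proof -
  interpret natural_transformation C D F G \<alpha> by fact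
  \<comment> \<open>The record of a transformation contains its source and target functors, so these
    must agree as well as the components.\<close>
  have "id_ftor D \<odot> F = F" "id_ftor D \<odot> G = G"
    by (rule id_ftor_fcomp, unfold_locales)+
  then show ?thesis
    using nsrc ntgt ncmp_ext ncmp_arr
    by (cases \<alpha>) (auto simp: whisker_left_def id_ftor_def F.fsrc extensional_def fun_eq_iff)
qed

lemma whisker_right_id_ftor:
  assumes "natural_transformation C D F G \<alpha>"
  shows "\<alpha> \<lhd> id_ftor C = \<alpha>"
proof -
  interpret natural_transformation C D F G \<alpha> by fact
  have "F \<odot> id_ftor C = F" "G \<odot> id_ftor C = G"
    by (rule fcomp_id_ftor, unfold_locales)+
  then show ?thesis
    using nsrc ntgt ncmp_ext
    by (cases \<alpha>) (auto simp: whisker_right_def id_ftor_def extensional_def fun_eq_iff)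
qed

section \<open>Whiskering against vertical composition, functor composition and other
  whiskerings\<close>

lemma whisker_left_vcomp:
  assumes "natural_transformation C D F G \<alpha>" and "natural_transformation C D G K \<beta>"
    and "is_functor D E H"
  shows "H \<rhd> (\<beta> \<bullet> \<alpha>) = (H \<rhd> \<beta>) \<bullet> (H \<rhd> \<alpha>)"
proof -
  interpret \<alpha>: natural_transformation C D F G \<alpha> by fact
  interpret \<beta>: natural_transformation C D G K \<beta> by fact
  interpret H: is_functor D E H by fact
  show ?thesis
    by (auto simp: whisker_left_def vcomp_def fcomp_def fun_eq_iff restrict_def \<alpha>.nsrc \<alpha>.F.fsrc
        \<alpha>.F.ftgt \<beta>.nsrc \<alpha>.G.fsrc H.ftgt \<alpha>.ncmp_arr \<alpha>.cod_ncmp \<beta>.ncmp_arr \<beta>.dom_ncmp intro!: H.farr_cmp)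
qed

lemma whisker_right_vcomp:
  assumes "natural_transformation C D F G \<alpha>" and "is_functor B C H"
  shows "(\<beta> \<bullet> \<alpha>) \<lhd> H = (\<beta> \<lhd> H) \<bullet> (\<alpha> \<lhd> H)"
proof -
  interpret natural_transformation C D F G \<alpha> by fact
  interpret H: is_functor B C H by fact
  show ?thesis
    by (auto simp: whisker_right_def vcomp_def fcomp_def fun_eq_iff restrict_def nsrc F.fsrc
        F.ftgt H.fsrc H.fobj_obj)
qed

lemma whisker_right_fcomp:
  assumes "natural_transformation C D F G \<alpha>" and "is_functor B C H" and "is_functor A B K"
  shows "\<alpha> \<lhd> (H \<odot> K) = \<alpha> \<lhd> H \<lhd> K"
proof -
  interpret natural_transformation C D F G \<alpha> by fact
  interpret H: is_functor B C H by fact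
  interpret K: is_functor A B K by fact
  show ?thesis
    by (auto simp: whisker_right_def fcomp_def fun_eq_iff restrict_def nsrc ntgt H.fsrc K.fsrc
        K.fobj_obj K.farr_arr)
qed

lemma whisker_left_fcomp:
  assumes "natural_transformation C D F G \<alpha>" and "is_functor D E H"
  shows "(K \<odot> H) \<rhd> \<alpha> = K \<rhd> H \<rhd> \<alpha>"
proof -
  interpret natural_transformation C D F G \<alpha> by fact
  interpret H: is_functor D E H by fact
  show ?thesis
    by (auto simp: whisker_left_def fcomp_def fun_eq_iff restrict_def nsrc ntgt F.fsrc G.fsrc
        H.fsrc F.fobj_obj F.farr_arr G.fobj_obj G.farr_arr ncmp_arr)
qed

text \<open>The components coincide at once; the boundary functors coincide because composition of
  functors is strictly associative.\<close>

lemma whisker_left_whisker_right: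
  assumes "natural_transformation C D F G \<alpha>" and "is_functor D E H" and "is_functor B C K"
  shows "H \<rhd> (\<alpha> \<lhd> K) = (H \<rhd> \<alpha>) \<lhd> K"
proof -
  interpret natural_transformation C D F G \<alpha> by fact
  interpret H: is_functor D E H by fact
  interpret K: is_functor B C K by fact
  show ?thesis
    by (auto simp: whisker_left_def whisker_right_def fcomp_def fun_eq_iff restrict_def nsrc ntgt
        F.fsrc G.fsrc K.fsrc K.fobj_obj K.farr_arr)
qed

text \<open>At an object \<open>x\<close> this is naturality of \<open>\<beta>\<close> at the arrow
  \<open>ncmp \<alpha> x\<close>. It is the decisive step in both compatibility conditions with
  \<open>\<chi>\<close> below.\<close>

lemma interchange:
  assumes "natural_transformation C D F G \<alpha>" and "natural_transformation D E H K \<beta>"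
  shows "(\<beta> \<lhd> G) \<bullet> (H \<rhd> \<alpha>) = (K \<rhd> \<alpha>) \<bullet> (\<beta> \<lhd> F)"
proof -
  interpret \<alpha>: natural_transformation C D F G \<alpha> by fact
  interpret \<beta>: natural_transformation D E H K \<beta> by fact
  have "Cmp E (ncmp \<beta> (fobj G x)) (farr H (ncmp \<alpha> x))
      = Cmp E (farr K (ncmp \<alpha> x)) (ncmp \<beta> (fobj F x))" if "x \<in> Obj C" for x
    using \<beta>.naturality[OF \<alpha>.ncmp_arr[OF that]] that by (simp add: \<alpha>.dom_ncmp \<alpha>.cod_ncmp)
  then show ?thesis
    by (auto simp: whisker_left_def whisker_right_def vcomp_def fcomp_def fun_eq_iff restrict_def
        \<alpha>.nsrc \<alpha>.ntgt \<beta>.nsrc \<beta>.ntgt \<alpha>.F.fsrc \<alpha>.G.fsrc \<beta>.F.ftgt)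
qed

section \<open>1-cells from and to trivial distributive laws\<close>

text \<open>Being a 1-cell includes that both endpoints are 0-cells; this settles the trivial
  endpoint. All structure is the identity of \<open>id_ftor C\<close>, so every axiom collapses by
  unit laws.\<close>

lemma dist_0cell_trivial_law:
  assumes "category C"
  shows "dist_0cell (trivial_law C)"
proof -
  note I = is_functor_id_ftor[OF assms]
  note J = natural_transformation_id_nt[OF I]
  show ?thesis
    using assms I J
    by (simp add: trivial_law_def is_comonad_def is_distributive_law_def id_comonad_def
        id_ftor_fcomp[OF I] id_ftor_whisker_left[OF J] whisker_right_id_ftor[OF J] id_nt_vcomp[OF J])
qed

lemma is_functorD:
  assumes "is_functor C D F"
  shows "category C" and "category D"
  using assms by (auto simp: is_functor_def)

text \<open>As an equivalence this covers both the construction and the classification of 1-cells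
  out of a trivial law. Only the direction from coalgebras to 1-cells uses the axioms of
  \<open>T\<close> and \<open>\<chi>\<close>.\<close>

lemma dist_1cell_from_trivial_law_iff:
  assumes "dist_0cell (B, \<chi>, T, S)"
  shows "dist_1cell (trivial_law Y) (B, \<chi>, T, S) (\<Sigma>, \<sigma>, \<gamma>)
    \<longleftrightarrow> is_coalgebra B S \<Sigma> Y \<gamma> \<and> \<sigma> = counit T \<lhd> \<Sigma>" (is "?cell \<longleftrightarrow> ?coalg")
proof
  note simps = trivial_law_def id_comonad_def is_coalgebra_def
  { assume c: ?cell
    then have \<Sigma>: "is_functor Y B \<Sigma>"
      by (simp add: trivial_law_def)
    \<comment> \<open>The source comonads are identities, so
      \<open>\<Sigma> \<odot> id_ftor Y\<close> becomes \<open>\<Sigma>\<close> and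
      \<open>\<gamma>\<close> gets the type of a coalgebra structure.\<close>
    have \<sigma>: "natural_transformation Y B (Ftor T \<odot> \<Sigma>) \<Sigma> \<sigma>"
      and \<gamma>: "natural_transformation Y B \<Sigma> (Ftor S \<odot> \<Sigma>) \<gamma>"
      using c by (simp_all add: simps fcomp_id_ftor[OF \<Sigma>])
    note I = is_functor_id_ftor[OF is_functorD(1)[OF \<Sigma>]]
    show ?coalg
      using c \<Sigma> \<gamma>
      by (simp add: simps whisker_left_id_nt[OF I \<Sigma>] fcomp_id_ftor[OF \<Sigma>] id_nt_vcomp[OF \<sigma>]
          vcomp_id_nt[OF \<gamma>] whisker_right_id_ftor[OF \<gamma>]) }
  { assume c: ?coalg
    then have \<Sigma>: "is_functor Y B \<Sigma>" and \<gamma>: "natural_transformation Y B \<Sigma> (Ftor S \<odot> \<Sigma>) \<gamma>"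
      and eq: "\<sigma> = counit T \<lhd> \<Sigma>"
      by (simp_all add: is_coalgebra_def)
    have T: "is_functor B B (Ftor T)" and S: "is_functor B B (Ftor S)"
      and \<epsilon>: "natural_transformation B B (Ftor T) (id_ftor B) (counit T)"
      and \<Delta>: "natural_transformation B B (Ftor T) (Ftor T \<odot> Ftor T) (comult T)"
      and \<chi>: "natural_transformation B B (Ftor T \<odot> Ftor S) (Ftor S \<odot> Ftor T) \<chi>"
      and counit: "(Ftor T \<rhd> counit T) \<bullet> comult T = id_nt (Ftor T)"
      and \<chi>\<epsilon>: "(Ftor S \<rhd> counit T) \<bullet> \<chi> = counit T \<lhd> Ftor S"
      using assms by (simp_all add: is_comonad_def is_distributive_law_def)
    have \<sigma>: "natural_transformation Y B (Ftor T \<odot> \<Sigma>) \<Sigma> \<sigma>"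
      using natural_transformation_whisker_right[OF \<epsilon> \<Sigma>]
      by (simp add: id_ftor_fcomp[OF \<Sigma>] eq)
    note I = is_functor_id_ftor[OF is_functorD(1)[OF \<Sigma>]]
    note T\<gamma> = natural_transformation_whisker_left[OF \<gamma> T]
    \<comment> \<open>The comultiplication axiom for \<open>\<sigma>\<close> with the identity cells
      removed. The last two factors form a counit law of \<open>T\<close> whiskered by
      \<open>\<Sigma>\<close>, hence cancel.\<close>
    have comult: "\<sigma> = \<sigma> \<bullet> (Ftor T \<rhd> \<sigma>) \<bullet> (comult T \<lhd> \<Sigma>)"
    proof -
      have "\<sigma> \<bullet> (Ftor T \<rhd> \<sigma>) \<bullet> (comult T \<lhd> \<Sigma>)
          = \<sigma> \<bullet> ((Ftor T \<rhd> counit T) \<lhd> \<Sigma>) \<bullet> (comult T \<lhd> \<Sigma>)"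
        by (simp add: eq whisker_left_whisker_right[OF \<epsilon> T \<Sigma>])
      also have "\<dots> = \<sigma> \<bullet> (((Ftor T \<rhd> counit T) \<bullet> comult T) \<lhd> \<Sigma>)"
        by (simp add: whisker_right_vcomp[OF \<Delta> \<Sigma>])
      also have "\<dots> = \<sigma> \<bullet> (id_nt (Ftor T) \<lhd> \<Sigma>)"
        by (simp add: counit)
      also have "\<dots> = \<sigma>"
        by (simp add: whisker_right_id_nt[OF T \<Sigma>] vcomp_id_nt[OF \<sigma>])
      finally show ?thesis by simp
    qed
    have hexagon: "\<gamma> \<bullet> \<sigma> = (Ftor S \<rhd> \<sigma>) \<bullet> (\<chi> \<lhd> \<Sigma>) \<bullet> (Ftor T \<rhd> \<gamma>)"
    proof -
      \<comment> \<open>Boundaries are rebracketed so that the three factors are composable in the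
        form that \<open>vcomp_assoc\<close> expects.\<close>
      have S\<epsilon>: "natural_transformation Y B ((Ftor S \<odot> Ftor T) \<odot> \<Sigma>) (Ftor S \<odot> \<Sigma>) (Ftor S \<rhd> \<sigma>)"
        using natural_transformation_whisker_left[OF \<sigma> S] by (simp add: fcomp_assoc[OF \<Sigma> T])
      have \<chi>\<Sigma>: "natural_transformation Y B (Ftor T \<odot> Ftor S \<odot> \<Sigma>) ((Ftor S \<odot> Ftor T) \<odot> \<Sigma>) (\<chi> \<lhd> \<Sigma>)"
        using natural_transformation_whisker_right[OF \<chi> \<Sigma>] by (simp add: fcomp_assoc[OF \<Sigma> S])
      have "(Ftor S \<rhd> \<sigma>) \<bullet> (\<chi> \<lhd> \<Sigma>) \<bullet> (Ftor T \<rhd> \<gamma>) = ((Ftor S \<rhd> \<sigma>) \<bullet> (\<chi> \<lhd> \<Sigma>)) \<bullet> (Ftor T \<rhd> \<gamma>)"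
        by (rule vcomp_assoc[OF T\<gamma> \<chi>\<Sigma> S\<epsilon>])
      also have "\<dots> = (((Ftor S \<rhd> counit T) \<bullet> \<chi>) \<lhd> \<Sigma>) \<bullet> (Ftor T \<rhd> \<gamma>)"
        by (simp add: eq whisker_left_whisker_right[OF \<epsilon> S \<Sigma>] whisker_right_vcomp[OF \<chi> \<Sigma>])
      also have "\<dots> = (counit T \<lhd> (Ftor S \<odot> \<Sigma>)) \<bullet> (Ftor T \<rhd> \<gamma>)"
        by (simp add: \<chi>\<epsilon> whisker_right_fcomp[OF \<epsilon> S \<Sigma>])
      \<comment> \<open>Interchange slides \<open>\<gamma>\<close> past the counit; the counit ends
        at \<open>id_ftor B\<close>, so the functor \<open>T\<close> in front of
        \<open>\<gamma>\<close> disappears.\<close>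
      also have "\<dots> = (id_ftor B \<rhd> \<gamma>) \<bullet> (counit T \<lhd> \<Sigma>)"
        by (rule interchange[OF \<gamma> \<epsilon>])
      also have "\<dots> = \<gamma> \<bullet> \<sigma>"
        by (simp add: eq id_ftor_whisker_left[OF \<gamma>])
      finally show ?thesis by simp
    qed
    show ?cell
      \<comment> \<open>Reversing \<open>eq\<close> folds \<open>counit T \<lhd> \<Sigma>\<close>
        back into \<open>\<sigma>\<close>, the form in which \<open>comult\<close> and
        \<open>hexagon\<close> are stated.\<close>
      using c assms \<sigma> comult hexagon dist_0cell_trivial_law[OF is_functorD(1)[OF \<Sigma>]]
      by (simp add: simps whisker_left_id_nt[OF I \<Sigma>] fcomp_id_ftor[OF \<Sigma>] id_nt_vcomp[OF \<sigma>]
          vcomp_id_nt[OF \<gamma>] whisker_right_id_ftor[OF \<gamma>] whisker_right_id_ftor[OF \<sigma>]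
          flip: eq) }
qed

text \<open>Dual to the previous equivalence: now the target comonads are identities,
  \<open>\<sigma>\<close> carries the opcoalgebra structure, and the counit axiom fixes
  \<open>\<gamma>\<close>.\<close>

lemma dist_1cell_to_trivial_law_iff:
  assumes "dist_0cell (B, \<chi>, T, S)"
  shows "dist_1cell (B, \<chi>, T, S) (trivial_law Z) (\<Sigma>, \<sigma>, \<gamma>)
    \<longleftrightarrow> is_opcoalgebra B T \<Sigma> Z \<sigma> \<and> \<gamma> = \<Sigma> \<rhd> counit S" (is "?cell \<longleftrightarrow> ?opcoalg")
proof
  note simps = trivial_law_def id_comonad_def is_opcoalgebra_def
  { assume c: ?cell
    then have \<Sigma>: "is_functor B Z \<Sigma>"
      by (simp add: trivial_law_def)
    have \<sigma>: "natural_transformation B Z \<Sigma> (\<Sigma> \<odot> Ftor T) \<sigma>"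
      and \<gamma>: "natural_transformation B Z (\<Sigma> \<odot> Ftor S) \<Sigma> \<gamma>"
      using c by (simp_all add: simps id_ftor_fcomp[OF \<Sigma>])
    note I = is_functor_id_ftor[OF is_functorD(2)[OF \<Sigma>]]
    show ?opcoalg
      using c \<Sigma> \<sigma>
      by (simp add: simps whisker_right_id_nt[OF I \<Sigma>] id_ftor_fcomp[OF \<Sigma>] id_nt_vcomp[OF \<gamma>]
          vcomp_id_nt[OF \<sigma>] id_ftor_whisker_left[OF \<sigma>]) }
  { assume c: ?opcoalg
    then have \<Sigma>: "is_functor B Z \<Sigma>" and \<sigma>: "natural_transformation B Z \<Sigma> (\<Sigma> \<odot> Ftor T) \<sigma>"
      and eq: "\<gamma> = \<Sigma> \<rhd> counit S"
      by (simp_all add: is_opcoalgebra_def)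
    have T: "is_functor B B (Ftor T)" and S: "is_functor B B (Ftor S)"
      and \<epsilon>: "natural_transformation B B (Ftor S) (id_ftor B) (counit S)"
      and \<Delta>: "natural_transformation B B (Ftor S) (Ftor S \<odot> Ftor S) (comult S)"
      and \<chi>: "natural_transformation B B (Ftor T \<odot> Ftor S) (Ftor S \<odot> Ftor T) \<chi>"
      and counit: "(counit S \<lhd> Ftor S) \<bullet> comult S = id_nt (Ftor S)"
      and \<chi>\<epsilon>: "(counit S \<lhd> Ftor T) \<bullet> \<chi> = Ftor T \<rhd> counit S"
      using assms by (simp_all add: is_comonad_def is_distributive_law_def)
    have \<gamma>: "natural_transformation B Z (\<Sigma> \<odot> Ftor S) \<Sigma> \<gamma>"
      using natural_transformation_whisker_left[OF \<epsilon> \<Sigma>]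
      by (simp add: fcomp_id_ftor[OF \<Sigma>] eq)
    note I = is_functor_id_ftor[OF is_functorD(2)[OF \<Sigma>]]
    \<comment> \<open>These two typings, with the identity functor absorbed in the target, allow
      \<open>\<Sigma>\<close> to be distributed over the composites below.\<close>
    have \<epsilon>S: "natural_transformation B B (Ftor S \<odot> Ftor S) (Ftor S) (counit S \<lhd> Ftor S)"
      using natural_transformation_whisker_right[OF \<epsilon> S] by (simp add: id_ftor_fcomp[OF S])
    have \<epsilon>T: "natural_transformation B B (Ftor S \<odot> Ftor T) (Ftor T) (counit S \<lhd> Ftor T)"
      using natural_transformation_whisker_right[OF \<epsilon> T] by (simp add: id_ftor_fcomp[OF T])
    \<comment> \<open>Here the other counit law, with the counit whiskered on the right by
      \<open>S\<close>, is the one that cancels.\<close>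
    have comult: "\<gamma> = \<gamma> \<bullet> (\<gamma> \<lhd> Ftor S) \<bullet> (\<Sigma> \<rhd> comult S)"
    proof -
      have "\<gamma> \<bullet> (\<gamma> \<lhd> Ftor S) \<bullet> (\<Sigma> \<rhd> comult S)
          = \<gamma> \<bullet> (\<Sigma> \<rhd> ((counit S \<lhd> Ftor S) \<bullet> comult S))"
        by (simp add: eq whisker_left_vcomp[OF \<Delta> \<epsilon>S \<Sigma>] whisker_left_whisker_right[OF \<epsilon> \<Sigma> S])
      also have "\<dots> = \<gamma>"
        by (simp add: counit whisker_left_id_nt[OF S \<Sigma>] vcomp_id_nt[OF \<gamma>])
      finally show ?thesis by simp
    qed
    have hexagon: "(\<gamma> \<lhd> Ftor T) \<bullet> (\<Sigma> \<rhd> \<chi>) \<bullet> (\<sigma> \<lhd> Ftor S) = \<sigma> \<bullet> \<gamma>"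
    proof -
      have \<gamma>T: "natural_transformation B Z (\<Sigma> \<odot> Ftor S \<odot> Ftor T) (\<Sigma> \<odot> Ftor T) (\<gamma> \<lhd> Ftor T)"
        using natural_transformation_whisker_right[OF \<gamma> T] by (simp add: fcomp_assoc[OF T S])
      have \<sigma>S: "natural_transformation B Z (\<Sigma> \<odot> Ftor S) (\<Sigma> \<odot> Ftor T \<odot> Ftor S) (\<sigma> \<lhd> Ftor S)"
        using natural_transformation_whisker_right[OF \<sigma> S] by (simp add: fcomp_assoc[OF S T])
      have "(\<gamma> \<lhd> Ftor T) \<bullet> (\<Sigma> \<rhd> \<chi>) \<bullet> (\<sigma> \<lhd> Ftor S) = ((\<gamma> \<lhd> Ftor T) \<bullet> (\<Sigma> \<rhd> \<chi>)) \<bullet> (\<sigma> \<lhd> Ftor S)"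
        by (rule vcomp_assoc[OF \<sigma>S natural_transformation_whisker_left[OF \<chi> \<Sigma>] \<gamma>T])
      also have "\<dots> = (\<Sigma> \<rhd> ((counit S \<lhd> Ftor T) \<bullet> \<chi>)) \<bullet> (\<sigma> \<lhd> Ftor S)"
        by (simp add: eq whisker_left_vcomp[OF \<chi> \<epsilon>T \<Sigma>] whisker_left_whisker_right[OF \<epsilon> \<Sigma> T])
      \<comment> \<open>Regrouping exposes \<open>\<Sigma> \<odot> Ftor T\<close>, the target of
        \<open>\<sigma>\<close>, so that interchange of \<open>\<sigma>\<close> with the counit of
        \<open>S\<close> applies.\<close>
      also have "\<dots> = ((\<Sigma> \<odot> Ftor T) \<rhd> counit S) \<bullet> (\<sigma> \<lhd> Ftor S)"
        by (simp add: \<chi>\<epsilon> whisker_left_fcomp[OF \<epsilon> T])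
      also have "\<dots> = (\<sigma> \<lhd> id_ftor B) \<bullet> (\<Sigma> \<rhd> counit S)"
        by (rule interchange[OF \<epsilon> \<sigma>, symmetric])
      also have "\<dots> = \<sigma> \<bullet> \<gamma>"
        by (simp add: eq whisker_right_id_ftor[OF \<sigma>])
      finally show ?thesis .
    qed
    show ?cell
      using c assms \<gamma> comult hexagon dist_0cell_trivial_law[OF is_functorD(2)[OF \<Sigma>]]
      by (simp add: simps whisker_right_id_nt[OF I \<Sigma>] id_ftor_fcomp[OF \<Sigma>] id_nt_vcomp[OF \<gamma>]
          vcomp_id_nt[OF \<sigma>] id_ftor_whisker_left[OF \<sigma>] id_ftor_whisker_left[OF \<gamma>]
          flip: eq) }
qed

theorem proposition3p4:
  fixes B :: "('o, 'a) cat"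
    and T S :: "('o, 'a) comonad"
    and \<chi> :: "('o, 'a, 'o, 'a) ntrans"
  assumes "category B"
    and "is_comonad B T"
    and "is_comonad B S"
    and "is_distributive_law B \<chi> T S"
  shows
    "(\<forall>(M :: ('y, 'ya, 'o, 'a) ftor) Y \<nu>.
        is_coalgebra B S M Y \<nu> \<longrightarrow>
        dist_1cell (trivial_law Y) (B, \<chi>, T, S) (M, counit T \<lhd> M, \<nu>))
   \<and> (\<forall>(N :: ('o, 'a, 'z, 'za) ftor) Z \<nu>.
        is_opcoalgebra B T N Z \<nu> \<longrightarrow>
        dist_1cell (B, \<chi>, T, S) (trivial_law Z) (N, \<nu>, N \<rhd> counit S))
   \<and> (\<forall>(Y :: ('y, 'ya) cat) \<Sigma> \<sigma> \<gamma>.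
        dist_1cell (trivial_law Y) (B, \<chi>, T, S) (\<Sigma>, \<sigma>, \<gamma>) \<longrightarrow>
        (\<exists>M \<nu>. is_coalgebra B S M Y \<nu> \<and> (\<Sigma>, \<sigma>, \<gamma>) = (M, counit T \<lhd> M, \<nu>)))
   \<and> (\<forall>(Z :: ('z, 'za) cat) \<Sigma> \<sigma> \<gamma>.
        dist_1cell (B, \<chi>, T, S) (trivial_law Z) (\<Sigma>, \<sigma>, \<gamma>) \<longrightarrow>
        (\<exists>N \<nu>. is_opcoalgebra B T N Z \<nu> \<and> (\<Sigma>, \<sigma>, \<gamma>) = (N, \<nu>, N \<rhd> counit S)))"
proof -
  have "dist_0cell (B, \<chi>, T, S)"
    using assms by simp
  note iffs = dist_1cell_from_trivial_law_iff[OF this] dist_1cell_to_trivial_law_iff[OF this]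
  show ?thesis
    \<comment> \<open>Each conjunct is now one direction of an equivalence; the existential
      witnesses are \<open>\<Sigma>\<close> with \<open>\<gamma>\<close> for coalgebras and
      \<open>\<Sigma>\<close> with \<open>\<sigma>\<close> for opcoalgebras.\<close>
    unfolding iffs by blast
qed

end
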